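(* Let $G = (\mathbb{Z}/2\mathbb{Z})^2 \times (\mathbb{Z}/4\mathbb{Z})^2$. Then there exists a primitive formally self dual subset $S \subset G$ with $|S| = 8$.
   Context: Let $G$ be a finite abelian group (written multiplicatively in the definitions below; for $G = (\mathbb{Z}/2\mathbb{Z})^2 \times (\mathbb{Z}/4\mathbb{Z})^2$ the group operation is componentwise addition). Let $\hat G$ be its dual group, i.e. the group of homomorphisms from $G$ to $\mathbb{C}^\ast$ under pointwise multiplication. For $\chi \in \hat G$ and $S \subset G$ write $\chi(S) = \sum_{x \in S} \chi(x)$. For $T \subset \hat G$ and $\chi \in \hat G$, the weight enumerator of $T$ is $\nu_T(\chi) = |\{(\phi,\psi) \in T \times T : \phi \cdot \psi^{-1} = \chi\}|$. Formally dual pair: two (nonempty) sets $S \subset G$ and $T \subset \hat G$ form a formally dual pair if for all $\chi \in \hat G$, $$|\chi(S)|^2 = \frac{|S|^2}{|T|}\, \nu_T(\chi).$$ Formally self dual: a set $S \subset G$ is formally self dual if there is a group isomorphism $\Delta : G \to \hat G$ such that $S$ and $\Delta(S)$ form a formally dual pair. Primitive: a set $S \subset G$ is primitive if none of the following holds: (1) $S \subset v \cdot H$ for some $v \in G$ and some proper subgroup $H < G$; (2) $S$ is a union of cosets of a non-trivial subgroup of $G$. *)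

theory Defs
  imports "HOL-Algebra.Algebra" "HOL.Complex"
begin

definition complex_units :: "complex monoid" where
  "complex_units = \<lparr>carrier = UNIV - {0}, monoid.mult = (*), one = 1\<rparr>"

text \<open>Elements of \<open>hom\<close> are only constrained on the carrier of \<open>G\<close>; characters are taken to be
  extensional so that each homomorphism is represented by exactly one function and
  cardinalities of sets of characters are meaningful.\<close>

definition dual_group :: "('a, 'b) monoid_scheme \<Rightarrow> ('a \<Rightarrow> complex) monoid" where
  "dual_group G =
    \<lparr>carrier = hom G complex_units \<inter> extensional (carrier G),
     monoid.mult = (\<lambda>\<phi> \<psi>. \<lambda>x\<in>carrier G. \<phi> x * \<psi> x),
     one = (\<lambda>x\<in>carrier G. 1)\<rparr>"

lemma comm_group_dual_group:
  assumes "group G"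
  shows "comm_group (dual_group G)"
proof -
  interpret group G by fact
  show ?thesis
  proof (rule comm_groupI)
    fix \<phi> assume \<phi>: "\<phi> \<in> carrier (dual_group G)"
    then have "(\<lambda>x\<in>carrier G. inverse (\<phi> x)) \<in> carrier (dual_group G)"
      by (auto simp: dual_group_def complex_units_def hom_def Pi_def)
    moreover have "(\<lambda>x\<in>carrier G. inverse (\<phi> x)) \<otimes>\<^bsub>dual_group G\<^esub> \<phi> = \<one>\<^bsub>dual_group G\<^esub>"
      using \<phi> by (auto simp: dual_group_def complex_units_def hom_def Pi_def fun_eq_iff)
    ultimately show "\<exists>\<psi>\<in>carrier (dual_group G). \<psi> \<otimes>\<^bsub>dual_group G\<^esub> \<phi> = \<one>\<^bsub>dual_group G\<^esub>"
      by blast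
  qed (auto simp: dual_group_def complex_units_def hom_def Pi_def fun_eq_iff extensional_def
        mult_ac)
qed

definition char_sum :: "('a \<Rightarrow> complex) \<Rightarrow> 'a set \<Rightarrow> complex" where
  "char_sum \<chi> S = (\<Sum>x\<in>S. \<chi> x)"

definition weight_enumerator ::
    "('a, 'b) monoid_scheme \<Rightarrow> ('a \<Rightarrow> complex) set \<Rightarrow> ('a \<Rightarrow> complex) \<Rightarrow> nat" where
  "weight_enumerator G T \<chi> =
    card {(\<phi>, \<psi>). \<phi> \<in> T \<and> \<psi> \<in> T \<and> \<phi> \<otimes>\<^bsub>dual_group G\<^esub> inv\<^bsub>dual_group G\<^esub> \<psi> = \<chi>}"

text \<open>The definitions below are meant for finite abelian \<open>G\<close>.\<close>

definition formally_dual_pair ::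
    "('a, 'b) monoid_scheme \<Rightarrow> 'a set \<Rightarrow> ('a \<Rightarrow> complex) set \<Rightarrow> bool" where
  "formally_dual_pair G S T \<longleftrightarrow>
    S \<subseteq> carrier G \<and> S \<noteq> {} \<and> T \<subseteq> carrier (dual_group G) \<and> T \<noteq> {} \<and>
    (\<forall>\<chi>\<in>carrier (dual_group G).
      (cmod (char_sum \<chi> S))\<^sup>2 =
        (real (card S))\<^sup>2 / real (card T) * real (weight_enumerator G T \<chi>))"

definition formally_self_dual :: "('a, 'b) monoid_scheme \<Rightarrow> 'a set \<Rightarrow> bool" where
  "formally_self_dual G S \<longleftrightarrow>
    S \<subseteq> carrier G \<and> (\<exists>\<Delta>\<in>iso G (dual_group G). formally_dual_pair G S (\<Delta> ` S))"

definition primitive_subset :: "('a, 'b) monoid_scheme \<Rightarrow> 'a set \<Rightarrow> bool" where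
  "primitive_subset G S \<longleftrightarrow>
    S \<subseteq> carrier G \<and>
    \<not> (\<exists>v\<in>carrier G. \<exists>H. subgroup H G \<and> H \<noteq> carrier G \<and> S \<subseteq> v <#\<^bsub>G\<^esub> H) \<and>
    \<not> (\<exists>H. subgroup H G \<and> H \<noteq> {\<one>\<^bsub>G\<^esub>} \<and>
          (\<exists>V\<subseteq>carrier G. S = (\<Union>v\<in>V. v <#\<^bsub>G\<^esub> H)))"

definition Z2_sq_Z4_sq :: "((int \<times> int) \<times> (int \<times> int)) monoid" where
  "Z2_sq_Z4_sq =
    (integer_mod_group 2 \<times>\<times> integer_mod_group 2) \<times>\<times> (integer_mod_group 4 \<times>\<times> integer_mod_group 4)"

end

(* An isomorphism \<Delta> from G to its dual group is the same as a nondegenerate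
   bicharacter \<Delta> x y. In terms of it, formal duality of S and \<Delta> ` S says that
   |\<Sum>s\<in>S. \<Delta> x s|^2 is card S times the number of t in S with x t in S, for all x in G.
   For the bicharacter i^(2 a a' + 2 b b' + c d' + d c'), a set S of size 8 satisfying these
   64 identities was found by computer search (simulated annealing). *)
theory Submission
  imports Defs
begin

section \<open>Criteria for formal self-duality and primitivity in a group\<close>

text \<open>A counted pair has the form (\<Delta> s, \<Delta> t), and injectivity of \<Delta> turns
  its condition into \<open>s = x \<otimes> t\<close>. So \<open>t\<close> alone determines the
  pair, and the count takes place in G instead of its dual.\<close>

lemma (in group) weight_enumerator_iso_image:
  assumes iso: "\<Delta> \<in> iso G (dual_group G)" and S: "S \<subseteq> carrier G" and x: "x \<in> carrier G"
  shows "weight_enumerator G (\<Delta> ` S) (\<Delta> x) = card {t \<in> S. x \<otimes> t \<in> S}"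
proof -
  interpret D: comm_group "dual_group G"
    by (rule comm_group_dual_group) (rule group_axioms)
  interpret \<Delta>: group_hom G "dual_group G" \<Delta>
    using iso by unfold_locales (auto simp: iso_def)
  have inj: "inj_on \<Delta> (carrier G)"
    using iso by (auto simp: iso_def bij_betw_def)
  have "{(\<phi>, \<psi>). \<phi> \<in> \<Delta> ` S \<and> \<psi> \<in> \<Delta> ` S \<and> \<phi> \<otimes>\<^bsub>dual_group G\<^esub> inv\<^bsub>dual_group G\<^esub> \<psi> = \<Delta> x} =
      (\<lambda>t. (\<Delta> (x \<otimes> t), \<Delta> t)) ` {t \<in> S. x \<otimes> t \<in> S}" (is "?L = ?R")
  proof (intro equalityI subsetI)
    fix p assume "p \<in> ?L"
    then obtain s t where st: "s \<in> S" "t \<in> S" "p = (\<Delta> s, \<Delta> t)"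
      and eq: "\<Delta> s \<otimes>\<^bsub>dual_group G\<^esub> inv\<^bsub>dual_group G\<^esub> \<Delta> t = \<Delta> x"
      by auto
    have c: "s \<in> carrier G" "t \<in> carrier G"
      using st S by auto
    have "\<Delta> s = \<Delta> (x \<otimes> t)"
      using eq c x by (metis D.inv_solve_right' \<Delta>.hom_closed \<Delta>.hom_mult)
    then have "s = x \<otimes> t"
      using inj c x by (simp add: inj_on_eq_iff del: \<Delta>.hom_mult)
    then show "p \<in> ?R"
      using st by auto
  next
    fix p assume "p \<in> ?R"
    then obtain t where t: "t \<in> S" "x \<otimes> t \<in> S" "p = (\<Delta> (x \<otimes> t), \<Delta> t)"
      by auto
    then have "t \<in> carrier G"
      using S by auto
    then have "\<Delta> (x \<otimes> t) \<otimes>\<^bsub>dual_group G\<^esub> inv\<^bsub>dual_group G\<^esub> \<Delta> t = \<Delta> x"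
      using x by (simp add: D.inv_solve_right')
    then show "p \<in> ?L"
      using t by auto
  qed
  moreover have "inj_on (\<lambda>t. (\<Delta> (x \<otimes> t), \<Delta> t)) {t \<in> S. x \<otimes> t \<in> S}"
    using inj S by (auto simp: inj_on_def)
  ultimately show ?thesis
    by (simp add: weight_enumerator_def card_image)
qed

lemma (in group) formally_self_dualI:
  assumes iso: "\<Delta> \<in> iso G (dual_group G)" and S: "S \<subseteq> carrier G" "finite S" "S \<noteq> {}"
    and eq: "\<And>x. x \<in> carrier G \<Longrightarrow>
      (cmod (char_sum (\<Delta> x) S))\<^sup>2 = real (card S * card {t \<in> S. x \<otimes> t \<in> S})"
  shows "formally_self_dual G S"
proof -
  have bij: "bij_betw \<Delta> (carrier G) (carrier (dual_group G))"
    using iso by (simp add: iso_def)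
  then have "card (\<Delta> ` S) = card S"
    using S by (meson bij_betw_def card_image inj_on_subset)
  then have "(cmod (char_sum \<chi> S))\<^sup>2 =
      (real (card S))\<^sup>2 / real (card (\<Delta> ` S)) * real (weight_enumerator G (\<Delta> ` S) \<chi>)"
    if "\<chi> \<in> carrier (dual_group G)" for \<chi>
  proof -
    obtain x where "x \<in> carrier G" "\<chi> = \<Delta> x"
      using \<open>\<chi> \<in> _\<close> bij by (auto simp: bij_betw_def)
    then show ?thesis
      using \<open>card (\<Delta> ` S) = card S\<close> S
      by (simp add: eq weight_enumerator_iso_image[OF iso] power2_eq_square[of "real _"])
  qed
  moreover have "\<Delta> ` S \<subseteq> carrier (dual_group G)"
    using bij S by (auto simp: bij_betw_def)
  ultimately show ?thesis
    using S iso by (auto simp: formally_self_dual_def formally_dual_pair_def)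
qed

text \<open>A coset of H that contains \<one> is H itself, so for \<open>S\<close> containing \<one>
  the first condition says that \<open>S\<close> generates G. A union of left cosets of H is stable
  under right multiplication by H, so the second follows once no nontrivial element stabilizes
  \<open>S\<close>.\<close>

lemma (in group) primitive_subsetI:
  assumes S: "S \<subseteq> carrier G" "\<one> \<in> S"
    and gen: "\<And>H. subgroup H G \<Longrightarrow> S \<subseteq> H \<Longrightarrow> H = carrier G"
    and stab: "\<And>h. h \<in> carrier G \<Longrightarrow> h \<noteq> \<one> \<Longrightarrow> \<exists>s\<in>S. s \<otimes> h \<notin> S"
  shows "primitive_subset G S"
proof -
  have "H = carrier G" if v: "v \<in> carrier G" and H: "subgroup H G" and sub: "S \<subseteq> v <#\<^bsub>G\<^esub> H" for v H
  proof -
    interpret H: subgroup H G by (rule H)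
    obtain h where h: "h \<in> H" "\<one> = v \<otimes> h"
      using S(2) sub by (auto simp: l_coset_def)
    then have "v = inv h"
      using v by (metis H.mem_carrier inv_equality)
    then have "v <#\<^bsub>G\<^esub> H = H"
      using H h by (simp add: coset_join3)
    then show ?thesis
      using gen H sub by simp
  qed
  moreover have "H = {\<one>}"
    if H: "subgroup H G" and V: "V \<subseteq> carrier G" and eq: "S = (\<Union>v\<in>V. v <#\<^bsub>G\<^esub> H)" for H V
  proof -
    interpret H: subgroup H G by (rule H)
    have "s \<otimes> h \<in> S" if "s \<in> S" "h \<in> H" for s h
    proof -
      obtain v k where "v \<in> V" "k \<in> H" "s = v \<otimes> k"
        using \<open>s \<in> S\<close> eq by (auto simp: l_coset_def)
      then have "s \<otimes> h = v \<otimes> (k \<otimes> h)" "k \<otimes> h \<in> H"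
        using V \<open>h \<in> H\<close> by (auto simp: m_assoc subset_iff)
      then show ?thesis
        using \<open>v \<in> V\<close> eq by (auto simp: l_coset_def)
    qed
    then show ?thesis
      using stab H.mem_carrier H.one_closed by blast
  qed
  ultimately show ?thesis
    using S unfolding primitive_subset_def by blast
qed

section \<open>The group in coordinates and its standard generators\<close>

lemma carrier_Z2_sq_Z4_sq:
  "carrier Z2_sq_Z4_sq = ({0, 1} \<times> {0, 1}) \<times> ({0, 1, 2, 3} \<times> {0, 1, 2, 3})"
proof -
  have "{0..<2} = {0, 1::int}" "{0..<4} = {0, 1, 2, 3::int}"
    by auto
  then show ?thesis
    by (simp add: Z2_sq_Z4_sq_def carrier_integer_mod_group)
qed

lemma mult_Z2_sq_Z4_sq:
  "((a, b), (c, d)) \<otimes>\<^bsub>Z2_sq_Z4_sq\<^esub> ((a', b'), (c', d')) =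
    (((a + a') mod 2, (b + b') mod 2), ((c + c') mod 4, (d + d') mod 4))"
  by (simp add: Z2_sq_Z4_sq_def)

lemma one_Z2_sq_Z4_sq: "\<one>\<^bsub>Z2_sq_Z4_sq\<^esub> = ((0, 0), (0, 0))"
  by (simp add: Z2_sq_Z4_sq_def)

interpretation G: group Z2_sq_Z4_sq
  unfolding Z2_sq_Z4_sq_def by (intro DirProd_group group_integer_mod_group)

lemma subgroup_Z2_sq_Z4_sq_eqI:
  assumes H: "subgroup H Z2_sq_Z4_sq"
    and e: "((1, 0), (0, 0)) \<in> H" "((0, 1), (0, 0)) \<in> H" "((0, 0), (1, 0)) \<in> H" "((0, 0), (0, 1)) \<in> H"
  shows "H = carrier Z2_sq_Z4_sq"
proof
  interpret subgroup H Z2_sq_Z4_sq by (rule H)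
  note * = m_closed[of "((a, b), (c, d))" "((a', b'), (c', d'))" for a b c d a' b' c' d',
      unfolded mult_Z2_sq_Z4_sq]
  have 0: "((0, 0), (0, 0)) \<in> H"
    using one_closed by (simp add: one_Z2_sq_Z4_sq)
  have a: "((a, 0), (0, 0)) \<in> H" if "a \<in> {0, 1}" for a
    using that e 0 by auto
  have b: "((0, b), (0, 0)) \<in> H" if "b \<in> {0, 1}" for b
    using that e 0 by auto
  \<comment> \<open>The two nested instances of closure supply the double and the triple of the
    generator.\<close>
  have c: "((0, 0), (c, 0)) \<in> H" if "c \<in> {0, 1, 2, 3}" for c
    using that 0 e(3) *[OF e(3) e(3)] *[OF e(3) *[OF e(3) e(3)]] by auto
  have d: "((0, 0), (0, d)) \<in> H" if "d \<in> {0, 1, 2, 3}" for d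
    using that 0 e(4) *[OF e(4) e(4)] *[OF e(4) *[OF e(4) e(4)]] by auto
  show "carrier Z2_sq_Z4_sq \<subseteq> H"
  proof
    fix x assume "x \<in> carrier Z2_sq_Z4_sq"
    then obtain p q r s where x: "x = ((p, q), (r, s))"
      and pqrs: "p \<in> {0, 1}" "q \<in> {0, 1}" "r \<in> {0, 1, 2, 3}" "s \<in> {0, 1, 2, 3}"
      unfolding carrier_Z2_sq_Z4_sq by blast
    \<comment> \<open>The coordinates are already reduced, so the reductions introduced by the group
      law disappear.\<close>
    have mod: "p mod 2 = p" "q mod 2 = q" "r mod 4 = r" "s mod 4 = s"
      using pqrs by auto
    show "x \<in> H"
      using *[OF *[OF a[OF pqrs(1)] b[OF pqrs(2)]] *[OF c[OF pqrs(3)] d[OF pqrs(4)]]]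
      by (simp add: x mod)
  qed
qed (rule subgroup.subset[OF H])

section \<open>The bicharacter and the isomorphism onto the dual group\<close>

text \<open>An exponent of \<i>, relevant only modulo 4: the factor 2 embeds Z/2 into Z/4, and the
  Z/4 coordinates carry the hyperbolic form. The form is symmetric, so multiplicativity in one
  argument gives it in the other.\<close>

fun pairing :: "(int \<times> int) \<times> (int \<times> int) \<Rightarrow> (int \<times> int) \<times> (int \<times> int) \<Rightarrow> int" where
  "pairing ((a, b), (c, d)) ((a', b'), (c', d')) = 2 * a * a' + 2 * b * b' + c * d' + d * c'"

text \<open>The restriction to the carrier matches the extensional characters of
  \<open>dual_group\<close>.\<close>

definition bichar :: "(int \<times> int) \<times> (int \<times> int) \<Rightarrow> (int \<times> int) \<times> (int \<times> int) \<Rightarrow> complex" where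
  "bichar x = (\<lambda>y\<in>carrier Z2_sq_Z4_sq. \<i> powi pairing x y)"

lemma i_powi_add_4_mult: "\<i> powi (k + 4 * m) = \<i> powi k"
proof -
  have "\<i> powi (4 * m) = (\<i> powi 4) powi m"
    by (rule power_int_mult)
  then show ?thesis
    by (simp add: power_int_add)
qed

lemma i_powi_mod_4: "\<i> powi (k mod 4) = \<i> powi k"
  by (metis i_powi_add_4_mult mod_mult_div_eq)

lemma pairing_commute: "pairing x y = pairing y x"
  by (cases "(x, y)" rule: pairing.cases) (simp add: algebra_simps)

text \<open>Reducing a coordinate modulo 2 changes the exponent by a multiple of 2 * 2, and reducing
  one modulo 4 by a multiple of 4. Neither affects the power of \<i>.\<close>

lemma i_powi_pairing_mult_left:
  "\<i> powi pairing (x \<otimes>\<^bsub>Z2_sq_Z4_sq\<^esub> y) z = \<i> powi pairing x z * \<i> powi pairing y z"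
proof -
  obtain a b c d a' b' c' d' p q r s
    where xyz: "x = ((a, b), (c, d))" "y = ((a', b'), (c', d'))" "z = ((p, q), (r, s))"
    by (metis surj_pair)
  \<comment> \<open>Naming the quotients makes the comparison of exponents a polynomial
    identity.\<close>
  have "\<exists>m. n mod k = n - k * m" for n k :: int
    by (metis minus_mult_div_eq_mod)
  then obtain t u v w where mods: "(a + a') mod 2 = a + a' - 2 * t" "(b + b') mod 2 = b + b' - 2 * u"
    "(c + c') mod 4 = c + c' - 4 * v" "(d + d') mod 4 = d + d' - 4 * w"
    by metis
  have "pairing (x \<otimes>\<^bsub>Z2_sq_Z4_sq\<^esub> y) z = (pairing x z + pairing y z) +
      4 * (- (t * p + u * q + v * s + w * r))"
    unfolding xyz mult_Z2_sq_Z4_sq mods by (simp add: algebra_simps)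
  then have "\<i> powi pairing (x \<otimes>\<^bsub>Z2_sq_Z4_sq\<^esub> y) z = \<i> powi (pairing x z + pairing y z)"
    by (simp only: i_powi_add_4_mult)
  then show ?thesis
    by (simp add: power_int_add)
qed

lemma i_powi_pairing_mult_right:
  "\<i> powi pairing x (y \<otimes>\<^bsub>Z2_sq_Z4_sq\<^esub> z) = \<i> powi pairing x y * \<i> powi pairing x z"
  unfolding pairing_commute[of x] by (rule i_powi_pairing_mult_left)

lemma bichar_in_dual: "bichar x \<in> carrier (dual_group Z2_sq_Z4_sq)"
  by (auto simp: bichar_def dual_group_def complex_units_def hom_def
      i_powi_pairing_mult_right G.m_closed)

lemma bichar_hom: "bichar \<in> hom Z2_sq_Z4_sq (dual_group Z2_sq_Z4_sq)"
  by (rule homI[OF bichar_in_dual])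
    (auto simp: bichar_def dual_group_def fun_eq_iff i_powi_pairing_mult_left)

text \<open>Evaluating at the four standard generators yields the powers of \<i> with exponents 2a,
  2b, d and c. All of these lie in 0..3, where the powers are distinct.\<close>

lemma bichar_inj: "inj_on bichar (carrier Z2_sq_Z4_sq)"
proof (rule inj_onI)
  fix x y assume xy: "x \<in> carrier Z2_sq_Z4_sq" "y \<in> carrier Z2_sq_Z4_sq" and eq: "bichar x = bichar y"
  obtain a b c d a' b' c' d' where *: "x = ((a, b), (c, d))" "y = ((a', b'), (c', d'))"
    by (metis surj_pair)
  have "\<i> powi pairing x z = \<i> powi pairing y z" if "z \<in> carrier Z2_sq_Z4_sq" for z
    using fun_cong[OF eq, of z] that by (simp add: bichar_def)
  from this[of "((1, 0), (0, 0))"] this[of "((0, 1), (0, 0))"]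
    this[of "((0, 0), (1, 0))"] this[of "((0, 0), (0, 1))"]
  have "\<i> powi (2 * a) = \<i> powi (2 * a')" "\<i> powi (2 * b) = \<i> powi (2 * b')"
    "\<i> powi c = \<i> powi c'" "\<i> powi d = \<i> powi d'"
    by (simp_all add: * carrier_Z2_sq_Z4_sq)
  moreover have "m = n"
    if "\<i> powi m = \<i> powi n" "m \<in> {0, 1, 2, 3}" "n \<in> {0, 1, 2, 3}" for m n
    using that by (auto simp: power3_eq_cube complex_eq_iff)
  moreover have "2 * a \<in> {0, 1, 2, 3}" "2 * a' \<in> {0, 1, 2, 3}"
    "2 * b \<in> {0, 1, 2, 3}" "2 * b' \<in> {0, 1, 2, 3}"
    "c \<in> {0, 1, 2, 3}" "c' \<in> {0, 1, 2, 3}" "d \<in> {0, 1, 2, 3}" "d' \<in> {0, 1, 2, 3}"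
    using xy by (auto simp: * carrier_Z2_sq_Z4_sq simp del: mult_cancel_left)
  ultimately have "2 * a = 2 * a'" "2 * b = 2 * b'" "c = c'" "d = d'"
    by metis+
  then show "x = y"
    by (simp add: *)
qed

lemma fourth_root_of_unity:
  fixes z :: complex
  assumes "z ^ 4 = 1"
  obtains k :: int where "k \<in> {0, 1, 2, 3}" "z = \<i> powi k"
proof -
  have "(z - 1) * (z + 1) * (z - \<i>) * (z + \<i>) = z ^ 4 - 1"
    by (simp add: algebra_simps power_numeral_reduce)
  then have "z = 1 \<or> z = - 1 \<or> z = \<i> \<or> z = - \<i>"
    using assms by (auto simp: eq_neg_iff_add_eq_0)
  then show thesis
    using that[of 0] that[of 1] that[of 2] that[of 3] by (auto simp: power3_eq_cube)
qed

text \<open>The exponent is written \<open>2 * k\<close> to match the factor 2 on the Z/2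
  coordinates of \<open>pairing\<close>.\<close>

lemma square_root_of_unity:
  fixes z :: complex
  assumes "z ^ 2 = 1"
  obtains k :: int where "k \<in> {0, 1}" "z = \<i> powi (2 * k)"
  using assms that[of 0] that[of 1] by (auto simp: power2_eq_1_iff)

text \<open>A character is determined by its values at the four generators, which are roots of unity
  of order dividing 2 or 4. The preimage \<open>x\<close> is read off from these exponents.\<close>

lemma bichar_surj:
  assumes \<chi>: "\<chi> \<in> carrier (dual_group Z2_sq_Z4_sq)"
  shows "\<chi> \<in> bichar ` carrier Z2_sq_Z4_sq"
proof -
  have nz: "\<chi> y \<noteq> 0" if "y \<in> carrier Z2_sq_Z4_sq" for y
    using \<chi> that by (auto simp: dual_group_def complex_units_def hom_def)
  have mult: "\<chi> (y \<otimes>\<^bsub>Z2_sq_Z4_sq\<^esub> z) = \<chi> y * \<chi> z"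
    if "y \<in> carrier Z2_sq_Z4_sq" "z \<in> carrier Z2_sq_Z4_sq" for y z
    using \<chi> that by (auto simp: dual_group_def complex_units_def hom_def)
  have one: "\<chi> ((0, 0), (0, 0)) = 1"
    using mult[of "((0, 0), (0, 0))" "((0, 0), (0, 0))"] nz[of "((0, 0), (0, 0))"]
    by (simp add: carrier_Z2_sq_Z4_sq mult_Z2_sq_Z4_sq)
  have sq: "\<chi> y ^ 2 = 1"
    if "y \<in> carrier Z2_sq_Z4_sq" "y \<otimes>\<^bsub>Z2_sq_Z4_sq\<^esub> y = ((0, 0), (0, 0))" for y
    using mult[of y y] that one by (simp add: power2_eq_square)
  have qu: "\<chi> y ^ 4 = 1"
    if y: "y \<in> carrier Z2_sq_Z4_sq"
      "(y \<otimes>\<^bsub>Z2_sq_Z4_sq\<^esub> y) \<otimes>\<^bsub>Z2_sq_Z4_sq\<^esub> (y \<otimes>\<^bsub>Z2_sq_Z4_sq\<^esub> y) = ((0, 0), (0, 0))" for y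
    using mult[of "y \<otimes>\<^bsub>Z2_sq_Z4_sq\<^esub> y" "y \<otimes>\<^bsub>Z2_sq_Z4_sq\<^esub> y"] mult[of y y] y one
    by (simp add: G.m_closed power4_eq_xxxx mult.assoc)
  obtain a where a: "a \<in> {0, 1}" "\<chi> ((1, 0), (0, 0)) = \<i> powi (2 * a)"
    by (rule square_root_of_unity[OF sq[of "((1, 0), (0, 0))"]])
      (auto simp: carrier_Z2_sq_Z4_sq mult_Z2_sq_Z4_sq)
  obtain b where b: "b \<in> {0, 1}" "\<chi> ((0, 1), (0, 0)) = \<i> powi (2 * b)"
    by (rule square_root_of_unity[OF sq[of "((0, 1), (0, 0))"]])
      (auto simp: carrier_Z2_sq_Z4_sq mult_Z2_sq_Z4_sq)
  \<comment> \<open>\<open>pairing\<close> crosses the Z/4 coordinates, so \<open>c\<close> comes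
    from the last generator and \<open>d\<close> from the third.\<close>
  obtain c where c: "c \<in> {0, 1, 2, 3}" "\<chi> ((0, 0), (0, 1)) = \<i> powi c"
    by (rule fourth_root_of_unity[OF qu[of "((0, 0), (0, 1))"]])
      (auto simp: carrier_Z2_sq_Z4_sq mult_Z2_sq_Z4_sq)
  obtain d where d: "d \<in> {0, 1, 2, 3}" "\<chi> ((0, 0), (1, 0)) = \<i> powi d"
    by (rule fourth_root_of_unity[OF qu[of "((0, 0), (1, 0))"]])
      (auto simp: carrier_Z2_sq_Z4_sq mult_Z2_sq_Z4_sq)
  define x where "x = ((a, b), (c, d))"
  have x: "x \<in> carrier Z2_sq_Z4_sq"
    unfolding x_def carrier_Z2_sq_Z4_sq by (intro SigmaI a b c d)
  \<comment> \<open>The set where the two characters agree is a subgroup; it contains the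
    generators, so it is everything.\<close>
  let ?H = "{y \<in> carrier Z2_sq_Z4_sq. \<chi> y = \<i> powi pairing x y}"
  have "\<one>\<^bsub>Z2_sq_Z4_sq\<^esub> \<in> ?H"
    using one by (simp add: one_Z2_sq_Z4_sq carrier_Z2_sq_Z4_sq x_def)
  moreover have "inv\<^bsub>Z2_sq_Z4_sq\<^esub> y \<in> ?H" if "y \<in> ?H" for y
  proof -
    \<comment> \<open>Both sides are the common value at the identity; the nonzero factor
      \<open>\<chi> y\<close> is then cancelled.\<close>
    have "\<chi> y * \<chi> (inv\<^bsub>Z2_sq_Z4_sq\<^esub> y) = \<chi> y * \<i> powi pairing x (inv\<^bsub>Z2_sq_Z4_sq\<^esub> y)"
      using that \<open>\<one>\<^bsub>Z2_sq_Z4_sq\<^esub> \<in> ?H\<close> mult[of y "inv\<^bsub>Z2_sq_Z4_sq\<^esub> y"]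
        i_powi_pairing_mult_right[of x y "inv\<^bsub>Z2_sq_Z4_sq\<^esub> y"] by simp
    then show ?thesis
      using that nz by simp
  qed
  moreover have "y \<otimes>\<^bsub>Z2_sq_Z4_sq\<^esub> z \<in> ?H" if "y \<in> ?H" "z \<in> ?H" for y z
    using that by (simp add: mult i_powi_pairing_mult_right)
  ultimately have "subgroup ?H Z2_sq_Z4_sq"
    by (intro G.subgroupI) blast+
  then have "?H = carrier Z2_sq_Z4_sq"
    by (rule subgroup_Z2_sq_Z4_sq_eqI)
      (simp_all add: carrier_Z2_sq_Z4_sq a(2) b(2) c(2) d(2) x_def)
  then have "\<chi> y = bichar x y" if "y \<in> carrier Z2_sq_Z4_sq" for y
    using that by (auto simp: bichar_def)
  moreover have "\<chi> \<in> extensional (carrier Z2_sq_Z4_sq)"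
    "bichar x \<in> extensional (carrier Z2_sq_Z4_sq)"
    using \<chi> by (auto simp: dual_group_def bichar_def)
  ultimately show ?thesis
    using x by (metis extensionalityI imageI)
qed

lemma bichar_iso: "bichar \<in> iso Z2_sq_Z4_sq (dual_group Z2_sq_Z4_sq)"
  using bichar_hom bichar_inj bichar_surj bichar_in_dual
  by (auto simp: iso_def bij_betw_def)

section \<open>The eight-element set and its verification by evaluation\<close>

text \<open>Integer-valued, so that squared moduli of character sums can be evaluated without
  complex arithmetic.\<close>

definition re_i_power :: "int \<Rightarrow> int" where
  "re_i_power k = (if k mod 4 = 0 then 1 else if k mod 4 = 2 then - 1 else 0)"

definition im_i_power :: "int \<Rightarrow> int" where
  "im_i_power k = (if k mod 4 = 1 then 1 else if k mod 4 = 3 then - 1 else 0)"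

lemma i_powi_eq: "\<i> powi k = Complex (re_i_power k) (im_i_power k)"
proof -
  have "k mod 4 \<in> {0, 1, 2, 3}"
    by auto
  then show ?thesis
    unfolding i_powi_mod_4[of k, symmetric]
    by (auto simp: re_i_power_def im_i_power_def power3_eq_cube complex_eq_iff)
qed

definition example_set :: "((int \<times> int) \<times> (int \<times> int)) set" where
  "example_set = {((0, 0), (0, 0)), ((0, 0), (3, 2)), ((0, 1), (0, 1)), ((1, 1), (1, 2)),
     ((0, 0), (2, 2)), ((0, 1), (2, 1)), ((1, 0), (3, 2)), ((0, 1), (1, 0))}"

lemma example_set_subset: "example_set \<subseteq> carrier Z2_sq_Z4_sq"
  by (simp add: example_set_def carrier_Z2_sq_Z4_sq)

lemma card_example_set: "card example_set = 8"
  by (simp add: example_set_def)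

text \<open>The group law on plain tuples, computable without unfolding the product of monoid
  records.\<close>

fun add_mod :: "(int \<times> int) \<times> (int \<times> int) \<Rightarrow> (int \<times> int) \<times> (int \<times> int) \<Rightarrow> (int \<times> int) \<times> (int \<times> int)" where
  "add_mod ((a, b), (c, d)) ((a', b'), (c', d')) =
    (((a + a') mod 2, (b + b') mod 2), ((c + c') mod 4, (d + d') mod 4))"

lemma mult_eq_add_mod: "x \<otimes>\<^bsub>Z2_sq_Z4_sq\<^esub> y = add_mod x y"
  by (cases "(x, y)" rule: add_mod.cases) (simp add: mult_Z2_sq_Z4_sq)

text \<open>The 64 duality identities in executable form: the carrier is spelled out as an explicit
  finite set, and \<open>Set.filter\<close> stands for the set comprehension.\<close>

lemma example_set_check:
  "\<forall>x\<in>({0, 1} \<times> {0, 1}) \<times> ({0, 1, 2, 3} \<times> {0, 1, 2, 3}).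
    (\<Sum>s\<in>example_set. re_i_power (pairing x s))\<^sup>2 + (\<Sum>s\<in>example_set. im_i_power (pairing x s))\<^sup>2 =
    int (8 * card (Set.filter (\<lambda>t. add_mod x t \<in> example_set) example_set))"
  by code_simp

text \<open>The finite check behind the coset condition of primitivity: none of the 63 nonzero
  translations maps the set into itself.\<close>

lemma example_set_stabilizer:
  "\<forall>h\<in>({0, 1} \<times> {0, 1}) \<times> ({0, 1, 2, 3} \<times> {0, 1, 2, 3}).
    h \<noteq> ((0, 0), (0, 0)) \<longrightarrow> (\<exists>s\<in>example_set. add_mod s h \<notin> example_set)"
  by code_simp

lemma formally_self_dual_example_set: "formally_self_dual Z2_sq_Z4_sq example_set"
proof (rule G.formally_self_dualI[OF bichar_iso example_set_subset])
  show "finite example_set" "example_set \<noteq> {}"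
    by (simp_all add: example_set_def)
next
  fix x assume x: "x \<in> carrier Z2_sq_Z4_sq"
  let ?R = "\<Sum>s\<in>example_set. re_i_power (pairing x s)"
  let ?I = "\<Sum>s\<in>example_set. im_i_power (pairing x s)"
  have "char_sum (bichar x) example_set = (\<Sum>s\<in>example_set. \<i> powi pairing x s)"
    using example_set_subset by (auto simp: char_sum_def bichar_def intro!: sum.cong)
  also have "\<dots> = Complex (of_int ?R) (of_int ?I)"
    by (simp add: i_powi_eq complex_eq_iff)
  finally have "(cmod (char_sum (bichar x) example_set))\<^sup>2 = of_int (?R\<^sup>2 + ?I\<^sup>2)"
    by (simp add: cmod_power2)
  also have "?R\<^sup>2 + ?I\<^sup>2 = int (8 * card {t \<in> example_set. add_mod x t \<in> example_set})"
    using bspec[OF example_set_check x[unfolded carrier_Z2_sq_Z4_sq]] by (simp only: Set.filter_eq)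
  finally show "(cmod (char_sum (bichar x) example_set))\<^sup>2 =
      real (card example_set * card {t \<in> example_set. x \<otimes>\<^bsub>Z2_sq_Z4_sq\<^esub> t \<in> example_set})"
    by (simp add: card_example_set mult_eq_add_mod)
qed

lemma primitive_example_set: "primitive_subset Z2_sq_Z4_sq example_set"
proof (rule G.primitive_subsetI[OF example_set_subset])
  show "\<one>\<^bsub>Z2_sq_Z4_sq\<^esub> \<in> example_set"
    by (simp add: example_set_def one_Z2_sq_Z4_sq)
next
  fix H assume H: "subgroup H Z2_sq_Z4_sq" and sub: "example_set \<subseteq> H"
  interpret subgroup H Z2_sq_Z4_sq by (rule H)
  note * = m_closed[of "((a, b), (c, d))" "((a', b'), (c', d'))" for a b c d a' b' c' d',
      unfolded mult_Z2_sq_Z4_sq]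
  have S: "((0, 0), (3, 2)) \<in> H" "((0, 1), (0, 1)) \<in> H" "((0, 0), (2, 2)) \<in> H"
    "((1, 0), (3, 2)) \<in> H" "((0, 1), (1, 0)) \<in> H"
    using sub by (auto simp: example_set_def)
  \<comment> \<open>Modulo 4, (3, 2) + (2, 2) = (1, 0).\<close>
  have e3: "((0, 0), (1, 0)) \<in> H"
    using *[OF S(1) S(3)] by simp
  \<comment> \<open>Here (3, 2) + (2, 2) leaves (1, 0) in the Z/4 part, and adding the generator
    from \<open>e3\<close> three times subtracts it.\<close>
  have e1: "((1, 0), (0, 0)) \<in> H"
    using *[OF *[OF S(4) S(3)] *[OF e3 *[OF e3 e3]]] by simp
  have e2: "((0, 1), (0, 0)) \<in> H"
    using *[OF S(5) *[OF e3 *[OF e3 e3]]] by simp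
  have e4: "((0, 0), (0, 1)) \<in> H"
    using *[OF S(2) e2] by simp
  show "H = carrier Z2_sq_Z4_sq"
    by (rule subgroup_Z2_sq_Z4_sq_eqI[OF H e1 e2 e3 e4])
next
  fix h assume "h \<in> carrier Z2_sq_Z4_sq" "h \<noteq> \<one>\<^bsub>Z2_sq_Z4_sq\<^esub>"
  then show "\<exists>s\<in>example_set. s \<otimes>\<^bsub>Z2_sq_Z4_sq\<^esub> h \<notin> example_set"
    using example_set_stabilizer unfolding carrier_Z2_sq_Z4_sq one_Z2_sq_Z4_sq mult_eq_add_mod by blast
qed

theorem theorem2p1:
  shows "\<exists>S. S \<subseteq> carrier Z2_sq_Z4_sq \<and>
    primitive_subset Z2_sq_Z4_sq S \<and>
    formally_self_dual Z2_sq_Z4_sq S \<and> card S = 8"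
  using example_set_subset primitive_example_set formally_self_dual_example_set card_example_set
  by blast

end
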